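(* Let $t\geq 4$, $\beta=2^{t-1}$, and let $\mathcal{C}_1,\mathcal{C}_2\subseteq\mathbb{Z}_4^\beta$ be any two quaternary linear perfect codes of dual type $(0,\beta;\gamma_1,\delta_1)$ and $(0,\beta;\gamma_2,\delta_2)$, respectively. Then the intersection code $\mathcal{C}_1\cap\mathcal{C}_2$ is of dual type $(0,\beta;\gamma,\delta)$, where $\gamma$ and $\delta$ satisfy $$\delta\in\{\max(\delta_1,\delta_2),\ldots,\delta_1+\delta_2-1\}$$ and $$\max\big(\delta,\max(\gamma_1+\delta_1,\gamma_2+\delta_2)\big)\leq\gamma+\delta\leq\gamma_1+\gamma_2+\delta_1+\delta_2-1.$$
   Context: A quaternary linear code of length $\beta$ is a subgroup $\mathcal{C}$ of $\mathbb{Z}_4^{\beta}$; it is of type $(0,\beta;\gamma,\delta)$ if $\mathcal{C}\cong\mathbb{Z}_2^\gamma\times\mathbb{Z}_4^\delta$ as a group. Its dual is $\mathcal{C}^\perp=\{u\in\mathbb{Z}_4^\beta:\sum_j u_jv_j=0\in\mathbb{Z}_4 \text{ for all } v\in\mathcal{C}\}$, and $\mathcal{C}$ is of dual type $(0,\beta;\gamma,\delta)$ if $\mathcal{C}^\perp$ is of type $(0,\beta;\gamma,\delta)$. The Gray map $\phi:\mathbb{Z}_4^{\beta}\to\mathbb{Z}_2^{2\beta}$ applies coordinatewise $0\mapsto(0,0),\ 1\mapsto(0,1),\ 2\mapsto(1,1),\ 3\mapsto(1,0)$. A quaternary linear perfect code of length $\beta=2^{t-1}$ is a quaternary linear code $\mathcal{C}\subseteq\mathbb{Z}_4^\beta$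 such that $\phi(\mathcal{C})$ has the parameters of an extended perfect binary code: length $2^t$, $2^{2^t-t-1}$ codewords, minimum Hamming distance $4$. Standing convention: the all-ones vector $(1,\ldots,1)\in\mathbb{Z}_4^\beta$ belongs to $\mathcal{C}^\perp$ for every quaternary linear perfect code $\mathcal{C}$ (codes are considered up to coordinate permutation, not sign changes). *)

theory Defs
  imports "HOL-Algebra.Algebra"
begin

text \<open>
  Words of length \<open>n\<close> over \<open>\<int>\<^sub>m\<close> are functions on \<open>{..<n}\<close> (\<open>undefined\<close> elsewhere) with values in
  \<open>{0..<m}\<close>; the group operation is coordinatewise addition modulo \<open>m\<close>.
\<close>

definition Zmod_power :: "nat \<Rightarrow> nat \<Rightarrow> (nat \<Rightarrow> int) monoid" where
  "Zmod_power m n = product_group {..<n} (\<lambda>_. integer_mod_group m)"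

definition quaternary_linear_code :: "nat \<Rightarrow> (nat \<Rightarrow> int) set \<Rightarrow> bool" where
  "quaternary_linear_code \<beta> C \<longleftrightarrow> subgroup C (Zmod_power 4 \<beta>)"

definition of_type :: "nat \<Rightarrow> nat \<Rightarrow> nat \<Rightarrow> (nat \<Rightarrow> int) set \<Rightarrow> bool" where
  "of_type \<beta> \<gamma> \<delta> C \<longleftrightarrow>
     quaternary_linear_code \<beta> C \<and>
     (Zmod_power 4 \<beta>)\<lparr>carrier := C\<rparr> \<cong> Zmod_power 2 \<gamma> \<times>\<times> Zmod_power 4 \<delta>"

definition dual_code :: "nat \<Rightarrow> (nat \<Rightarrow> int) set \<Rightarrow> (nat \<Rightarrow> int) set" where
  "dual_code \<beta> C =
     {u \<in> carrier (Zmod_power 4 \<beta>). \<forall>v\<in>C. (\<Sum>j<\<beta>. u j * v j) mod 4 = 0}"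

definition of_dual_type :: "nat \<Rightarrow> nat \<Rightarrow> nat \<Rightarrow> (nat \<Rightarrow> int) set \<Rightarrow> bool" where
  "of_dual_type \<beta> \<gamma> \<delta> C \<longleftrightarrow>
     quaternary_linear_code \<beta> C \<and> of_type \<beta> \<gamma> \<delta> (dual_code \<beta> C)"

definition gray_pair :: "int \<Rightarrow> int \<times> int" where
  "gray_pair a =
     (if a = 0 then (0, 0) else if a = 1 then (0, 1) else if a = 2 then (1, 1) else (1, 0))"

text \<open>Coordinate \<open>j\<close> of \<open>u\<close> contributes the binary coordinates \<open>2 * j\<close> and \<open>2 * j + 1\<close>.\<close>

definition gray_map :: "nat \<Rightarrow> (nat \<Rightarrow> int) \<Rightarrow> (nat \<Rightarrow> int)" where
  "gray_map \<beta> u =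
     (\<lambda>k\<in>{..<2 * \<beta>}.
        if even k then fst (gray_pair (u (k div 2))) else snd (gray_pair (u (k div 2))))"

definition hamming_dist :: "nat \<Rightarrow> (nat \<Rightarrow> int) \<Rightarrow> (nat \<Rightarrow> int) \<Rightarrow> nat" where
  "hamming_dist n x y = card {i \<in> {..<n}. x i \<noteq> y i}"

text \<open>Only meaningful for finite codes with at least two codewords.\<close>

definition minimum_distance :: "nat \<Rightarrow> (nat \<Rightarrow> int) set \<Rightarrow> nat" where
  "minimum_distance n B = Min {hamming_dist n x y | x y. x \<in> B \<and> y \<in> B \<and> x \<noteq> y}"

definition extended_perfect_parameters :: "nat \<Rightarrow> (nat \<Rightarrow> int) set \<Rightarrow> bool" where
  "extended_perfect_parameters t B \<longleftrightarrow>
     B \<subseteq> carrier (Zmod_power 2 (2 ^ t)) \<and>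
     card B = 2 ^ (2 ^ t - t - 1) \<and>
     minimum_distance (2 ^ t) B = 4"

definition quaternary_linear_perfect_code :: "nat \<Rightarrow> (nat \<Rightarrow> int) set \<Rightarrow> bool" where
  "quaternary_linear_perfect_code t C \<longleftrightarrow>
     quaternary_linear_code (2 ^ (t - 1)) C \<and>
     extended_perfect_parameters t (gray_map (2 ^ (t - 1)) ` C)"

definition all_ones :: "nat \<Rightarrow> nat \<Rightarrow> int" where
  "all_ones \<beta> = (\<lambda>j\<in>{..<\<beta>}. 1)"

end

theory Submission
  imports Defs
begin

text \<open>
  The dual of \<open>C\<^sub>1 \<inter> C\<^sub>2\<close> is \<open>D = D\<^sub>1 + D\<^sub>2\<close> with \<open>D\<^sub>i\<close> the dual of \<open>C\<^sub>i\<close>. For a code of type \<open>(\<gamma>, \<delta>)\<close>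
  the doubled code has \<open>2^\<delta>\<close> elements and the 2-torsion \<open>2^(\<gamma> + \<delta>)\<close>; monotonicity of both gives the
  lower bounds. For the upper bounds, apply the formula \<open>|H + K| |H \<inter> K| = |H| |K|\<close> to \<open>2D = 2D\<^sub>1 + 2D\<^sub>2\<close>
  and to \<open>D\<close> itself: with \<open>j\<close> the all-ones word, \<open>2D\<^sub>1 \<inter> 2D\<^sub>2\<close> contains \<open>2j \<noteq> 0\<close>, and it is properly contained
  in \<open>D\<^sub>1 \<inter> D\<^sub>2\<close>, since \<open>j\<close> has order 4 and is therefore not a double.
\<close>

section \<open>Cardinalities of products of subgroups\<close>

lemma (in group) subset_set_mult:
  assumes H: "subgroup H G" and K: "subgroup K G"
  shows "H \<subseteq> H <#> K" and "K \<subseteq> H <#> K"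
proof -
  have "h \<otimes> \<one> \<in> H <#> K" if "h \<in> H" for h
    unfolding set_mult_def using that subgroup.one_closed[OF K] by blast
  then show "H \<subseteq> H <#> K" using subgroup.mem_carrier[OF H] by auto
  have "\<one> \<otimes> k \<in> H <#> K" if "k \<in> K" for k
    unfolding set_mult_def using that subgroup.one_closed[OF H] by blast
  then show "K \<subseteq> H <#> K" using subgroup.mem_carrier[OF K] by auto
qed

text \<open>All fibres of the multiplication map from \<open>H \<times> K\<close> onto
  \<open>H <#> K\<close> have the size of \<open>H \<inter> K\<close>; summing over the fibres gives
  the formula.\<close>

lemma (in group) card_set_mult_Int:
  assumes H: "subgroup H G" and K: "subgroup K G" and fin: "finite H" "finite K"
  shows "card (H <#> K) * card (H \<inter> K) = card H * card K"
proof -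
  let ?f = "\<lambda>(h, k). h \<otimes> k"
  note [simp] = subgroup.mem_carrier[OF H] subgroup.mem_carrier[OF K]
  have fibre: "card {p \<in> H \<times> K. ?f p = z} = card (H \<inter> K)" if z: "z \<in> H <#> K" for z
  proof -
    from z obtain h0 k0 where hk: "h0 \<in> H" "k0 \<in> K" "z = h0 \<otimes> k0"
      by (auto simp: set_mult_def)
    \<comment> \<open>Each point of the fibre over \<open>z\<close> arises from
      \<open>(h0, k0)\<close> by moving a common element \<open>x\<close> of \<open>H\<close> and
      \<open>K\<close> across the product.\<close>
    let ?g = "\<lambda>x. (h0 \<otimes> x, inv x \<otimes> k0)"
    have "inj_on ?g (H \<inter> K)"
      using hk by (auto intro!: inj_onI)
    moreover have "?g ` (H \<inter> K) = {p \<in> H \<times> K. ?f p = z}"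
    proof (intro equalityI subsetI)
      fix p assume "p \<in> ?g ` (H \<inter> K)"
      then show "p \<in> {p \<in> H \<times> K. ?f p = z}"
        using hk H K by (auto simp: subgroup.m_closed subgroup.m_inv_closed m_assoc inv_solve_left
            simp flip: m_assoc)
           (metis inv_closed inv_solve_right m_assoc m_closed subgroup.mem_carrier)
    next
      fix p assume "p \<in> {p \<in> H \<times> K. ?f p = z}"
      then obtain h k where p: "p = (h, k)" "h \<in> H" "k \<in> K" "h \<otimes> k = h0 \<otimes> k0"
        using hk by auto
      let ?x = "inv h0 \<otimes> h"
      have "h = h0 \<otimes> k0 \<otimes> inv k"
        using p hk by (metis inv_solve_right m_closed subgroup.mem_carrier[OF H] subgroup.mem_carrier[OF K])
      then have x: "?x = k0 \<otimes> inv k"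
        using hk p by (simp add: m_assoc inv_solve_left' flip: m_assoc)
      have "?x \<in> H" using hk p H by (simp add: subgroup.m_closed subgroup.m_inv_closed)
      moreover have "?x \<in> K" unfolding x using hk p K by (simp add: subgroup.m_closed subgroup.m_inv_closed)
      moreover have "h0 \<otimes> ?x = h" using hk p by (simp flip: m_assoc)
      moreover have "inv ?x \<otimes> k0 = k" unfolding x using hk p by (simp add: inv_mult_group m_assoc)
      ultimately show "p \<in> ?g ` (H \<inter> K)" using p by (intro image_eqI[of _ _ ?x]) auto
    qed
    ultimately show ?thesis by (metis card_image)
  qed
  have "finite (H <#> K)"
    using fin by (auto simp: set_mult_def)
  have "H \<times> K = (\<Union>z\<in>H <#> K. {p \<in> H \<times> K. ?f p = z})"
    by (auto simp: set_mult_def)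
  also have "card \<dots> = (\<Sum>z\<in>H <#> K. card {p \<in> H \<times> K. ?f p = z})"
    using fin \<open>finite (H <#> K)\<close> by (intro card_UN_disjoint) auto
  also have "\<dots> = card (H <#> K) * card (H \<inter> K)"
    by (simp add: fibre)
  finally show ?thesis by (simp add: card_cartesian_product)
qed

section \<open>The groups \<open>\<int>\<^sub>m\<^sup>n\<close>\<close>

lemma carrier_Zmod_power: "0 < m \<Longrightarrow> carrier (Zmod_power m n) = {..<n} \<rightarrow>\<^sub>E {0..<int m}"
  by (simp add: Zmod_power_def carrier_integer_mod_group)

lemma mult_Zmod_power: "x \<otimes>\<^bsub>Zmod_power m n\<^esub> y = (\<lambda>i\<in>{..<n}. (x i + y i) mod int m)"
  by (simp add: Zmod_power_def)

lemma one_Zmod_power: "\<one>\<^bsub>Zmod_power m n\<^esub> = (\<lambda>i\<in>{..<n}. 0)"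
  by (simp add: Zmod_power_def)

lemma group_Zmod_power: "group (Zmod_power m n)"
  by (simp add: Zmod_power_def)

lemma comm_group_Zmod_power: "comm_group (Zmod_power m n)"
  by (rule group.group_comm_groupI[OF group_Zmod_power]) (simp add: mult_Zmod_power add.commute)

lemma finite_carrier_Zmod_power: "0 < m \<Longrightarrow> finite (carrier (Zmod_power m n))"
  by (simp add: carrier_Zmod_power finite_PiE)

lemma card_carrier_Zmod_power: "0 < m \<Longrightarrow> card (carrier (Zmod_power m n)) = m ^ n"
  by (simp add: carrier_Zmod_power card_PiE)

lemma finite_code: "subgroup C (Zmod_power 4 n) \<Longrightarrow> finite C"
  by (meson finite_carrier_Zmod_power finite_subset subgroup.subset zero_less_numeral)

section \<open>Linear combinations\<close>

text \<open>Coefficients are unreduced integers, so they can be added, doubled and halved freely;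
  only the resulting word is reduced modulo 4. Members of the families from index \<open>k\<close>
  on do not count.\<close>

definition lincomb :: "nat \<Rightarrow> nat \<Rightarrow> (nat \<Rightarrow> int) \<Rightarrow> (nat \<Rightarrow> nat \<Rightarrow> int) \<Rightarrow> nat \<Rightarrow> int" where
  "lincomb n k c y = (\<lambda>i\<in>{..<n}. (\<Sum>j<k. c j * y j i) mod 4)"

lemma lincomb_eq_iff:
  "lincomb n k c y = lincomb n l d z \<longleftrightarrow>
     (\<forall>i<n. (\<Sum>j<k. c j * y j i) mod 4 = (\<Sum>j<l. d j * z j i) mod 4)"
  by (auto simp: lincomb_def restrict_def fun_eq_iff)

lemma lincomb_0: "lincomb n 0 c y = \<one>\<^bsub>Zmod_power 4 n\<^esub>"
  by (auto simp: lincomb_def one_Zmod_power restrict_def)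

lemma lincomb_eq_one_iff:
  "lincomb n k c y = \<one>\<^bsub>Zmod_power 4 n\<^esub> \<longleftrightarrow> (\<forall>i<n. (\<Sum>j<k. c j * y j i) mod 4 = 0)"
  by (auto simp: lincomb_def one_Zmod_power restrict_def fun_eq_iff)

lemma lincomb_zero: "lincomb n k (\<lambda>_. 0) y = \<one>\<^bsub>Zmod_power 4 n\<^esub>"
  by (simp add: lincomb_eq_one_iff)

text \<open>Comparing products instead of coefficients lets a factor 2 pass between coefficient and
  word, and lets coefficients of even words change modulo 2.\<close>

lemma lincomb_cong:
  assumes "\<And>i j. i < n \<Longrightarrow> j < k \<Longrightarrow> (c j * y j i) mod 4 = (d j * z j i) mod 4"
  shows "lincomb n k c y = lincomb n k d z"
  unfolding lincomb_eq_iff by (metis (mono_tags, lifting) assms lessThan_iff mod_sum_eq sum.cong)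

lemma lincomb_add:
  "lincomb n k c y \<otimes>\<^bsub>Zmod_power 4 n\<^esub> lincomb n k d y = lincomb n k (\<lambda>j. c j + d j) y"
  by (auto simp: lincomb_def mult_Zmod_power mod_simps sum.distrib algebra_simps intro!: restrict_ext)

lemma lincomb_Suc:
  "lincomb n (Suc k) c y = lincomb n k c y \<otimes>\<^bsub>Zmod_power 4 n\<^esub> lincomb n 1 (\<lambda>_. c k) (\<lambda>_. y k)"
  by (auto simp: lincomb_def mult_Zmod_power mod_simps intro!: restrict_ext)

text \<open>Combinations of length 1 act as scalar multiples. A natural multiple is a repeated sum,
  and an integer coefficient may be replaced by its natural residue modulo 4.\<close>

lemma lincomb_scalar_closed:
  assumes C: "subgroup C (Zmod_power 4 n)" and x: "x \<in> C"
  shows "lincomb n 1 (\<lambda>_. c) (\<lambda>_. x) \<in> C"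
proof -
  have nat: "lincomb n 1 (\<lambda>_. int m) (\<lambda>_. x) \<in> C" for m
  proof (induction m)
    case 0
    then show ?case using subgroup.one_closed[OF C] by (simp add: lincomb_def one_Zmod_power restrict_def)
  next
    case (Suc m)
    have "lincomb n 1 (\<lambda>_. int (Suc m)) (\<lambda>_. x) = lincomb n 1 (\<lambda>_. int m) (\<lambda>_. x) \<otimes>\<^bsub>Zmod_power 4 n\<^esub> x"
      by (auto simp: lincomb_def mult_Zmod_power mod_simps algebra_simps intro!: restrict_ext)
    then show ?case using subgroup.m_closed[OF C Suc x] by simp
  qed
  have "lincomb n 1 (\<lambda>_. c) (\<lambda>_. x) = lincomb n 1 (\<lambda>_. int (nat (c mod 4))) (\<lambda>_. x)"
    by (intro lincomb_cong) (simp add: mod_simps)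
  then show ?thesis using nat[of "nat (c mod 4)"] by argo
qed

lemma lincomb_closed:
  assumes C: "subgroup C (Zmod_power 4 n)" and y: "\<And>j. j < k \<Longrightarrow> y j \<in> C"
  shows "lincomb n k c y \<in> C"
  using y
proof (induction k)
  case 0
  then show ?case using subgroup.one_closed[OF C] by (simp add: lincomb_0)
next
  case (Suc k)
  then show ?case
    unfolding lincomb_Suc by (intro subgroup.m_closed[OF C] lincomb_scalar_closed[OF C]) auto
qed

section \<open>Squares and involutions in a commutative group\<close>

text \<open>The group is written multiplicatively; in \<open>Zmod_power 4 n\<close> this is the
  doubled code \<open>2C\<close>.\<close>

definition squares :: "('a, 'b) monoid_scheme \<Rightarrow> 'a set \<Rightarrow> 'a set" where
  "squares G C = (\<lambda>x. x \<otimes>\<^bsub>G\<^esub> x) ` C"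

definition two_torsion :: "('a, 'b) monoid_scheme \<Rightarrow> 'a set \<Rightarrow> 'a set" where
  "two_torsion G C = {x \<in> C. x \<otimes>\<^bsub>G\<^esub> x = \<one>\<^bsub>G\<^esub>}"

lemma (in comm_group) subgroup_squares:
  assumes "subgroup C G"
  shows "subgroup (squares G C) G"
proof -
  interpret C: subgroup C G by fact
  show ?thesis
  proof (rule subgroupI)
    show "squares G C \<subseteq> carrier G" by (auto simp: squares_def)
    show "squares G C \<noteq> {}" using C.one_closed unfolding squares_def by blast
    show "inv a \<in> squares G C" if "a \<in> squares G C" for a
      using that by (auto simp: squares_def inv_mult intro!: imageI)
    show "a \<otimes> b \<in> squares G C" if "a \<in> squares G C" "b \<in> squares G C" for a b
    proof -
      from that obtain x y where "x \<in> C" "y \<in> C" "a = x \<otimes> x" "b = y \<otimes> y"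
        by (auto simp: squares_def)
      then show ?thesis
        by (auto simp: squares_def m_ac intro!: image_eqI[of _ _ "x \<otimes> y"])
    qed
  qed
qed

lemma (in comm_group) subgroup_two_torsion:
  assumes "subgroup C G"
  shows "subgroup (two_torsion G C) G"
proof -
  interpret C: subgroup C G by fact
  show ?thesis
  proof (rule subgroupI)
    show "two_torsion G C \<noteq> {}" using C.one_closed by (auto simp: two_torsion_def intro!: exI[of _ \<one>])
    show "inv a \<in> two_torsion G C" if "a \<in> two_torsion G C" for a
      using that by (auto simp: two_torsion_def simp flip: inv_mult)
    show "a \<otimes> b \<in> two_torsion G C" if "a \<in> two_torsion G C" "b \<in> two_torsion G C" for a b
    proof -
      have [simp]: "a \<in> C" "b \<in> C" "a \<otimes> a = \<one>" "b \<otimes> b = \<one>"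
        using that by (auto simp: two_torsion_def)
      have "(a \<otimes> b) \<otimes> (a \<otimes> b) = (a \<otimes> a) \<otimes> (b \<otimes> b)"
        by (simp only: m_ac C.mem_carrier m_closed \<open>a \<in> C\<close> \<open>b \<in> C\<close>)
      then show ?thesis by (simp add: two_torsion_def)
    qed
  qed (auto simp: two_torsion_def)
qed

lemma (in comm_group) squares_set_mult:
  assumes "H \<subseteq> carrier G" "K \<subseteq> carrier G"
  shows "squares G (H <#> K) = squares G H <#> squares G K"
proof -
  have "(h \<otimes> k) \<otimes> (h \<otimes> k) = (h \<otimes> h) \<otimes> (k \<otimes> k)" if "h \<in> H" "k \<in> K" for h k
  proof -
    have "h \<in> carrier G" "k \<in> carrier G" using assms that by auto
    then show ?thesis by (simp add: m_ac)
  qed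
  then show ?thesis
    unfolding squares_def set_mult_def image_UN
    by (auto 4 4)
qed

lemma squares_mono: "C \<subseteq> D \<Longrightarrow> squares G C \<subseteq> squares G D"
  by (auto simp: squares_def)

lemma two_torsion_mono: "C \<subseteq> D \<Longrightarrow> two_torsion G C \<subseteq> two_torsion G D"
  by (auto simp: two_torsion_def)

section \<open>Reading off the type from cardinalities\<close>

lemma iso_card_squares_two_torsion:
  assumes G: "group G" and H: "group H" and "G \<cong> H"
  shows "card (carrier G) = card (carrier H)"
    and "card (squares G (carrier G)) = card (squares H (carrier H))"
    and "card (two_torsion G (carrier G)) = card (two_torsion H (carrier H))"
proof -
  from \<open>G \<cong> H\<close> obtain h where h: "h \<in> hom G H"
    and im: "h ` carrier G = carrier H" and inj: "inj_on h (carrier G)"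
    by (auto simp: is_iso_def iso_iff)
  interpret group_hom G H h
    using G H h by (simp add: group_hom_def group_hom_axioms_def)
  show "card (carrier G) = card (carrier H)"
    using inj im by (metis card_image)
  have "h ` squares G (carrier G) = squares H (carrier H)"
    unfolding squares_def im[symmetric] image_image by (intro image_cong) auto
  moreover have "inj_on h (squares G (carrier G))"
    by (rule inj_on_subset[OF inj]) (auto simp: squares_def)
  ultimately show "card (squares G (carrier G)) = card (squares H (carrier H))"
    by (metis card_image)
  have "h x \<otimes>\<^bsub>H\<^esub> h x = \<one>\<^bsub>H\<^esub> \<longleftrightarrow> x \<otimes>\<^bsub>G\<^esub> x = \<one>\<^bsub>G\<^esub>" if "x \<in> carrier G" for x
    using that inj_on_eq_iff[OF inj, of "x \<otimes>\<^bsub>G\<^esub> x" "\<one>\<^bsub>G\<^esub>"] by simp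
  then have "h ` two_torsion G (carrier G) = two_torsion H (carrier H)"
    unfolding two_torsion_def im[symmetric] by auto
  moreover have "inj_on h (two_torsion G (carrier G))"
    by (rule inj_on_subset[OF inj]) (auto simp: two_torsion_def)
  ultimately show "card (two_torsion G (carrier G)) = card (two_torsion H (carrier H))"
    by (metis card_image)
qed

text \<open>Doubling annihilates the factors of order 2 and sends each cyclic factor of order 4 onto
  \<open>{0, 2}\<close>, which is also the 2-torsion of that factor.\<close>

lemma card_standard_type:
  fixes \<gamma> \<delta> :: nat
  defines "T \<equiv> Zmod_power 2 \<gamma> \<times>\<times> Zmod_power 4 \<delta>"
  shows "card (carrier T) = 2 ^ (\<gamma> + 2 * \<delta>)"
    and "card (squares T (carrier T)) = 2 ^ \<delta>"
    and "card (two_torsion T (carrier T)) = 2 ^ (\<gamma> + \<delta>)"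
proof -
  have "(4::nat) ^ \<delta> = 2 ^ (2 * \<delta>)" by (simp add: power_mult)
  then show "card (carrier T) = 2 ^ (\<gamma> + 2 * \<delta>)"
    by (simp add: T_def DirProd_def card_cartesian_product card_carrier_Zmod_power power_add)
  have two: "card ({..<n} \<rightarrow>\<^sub>E {0, 2::int}) = 2 ^ n" for n :: nat
    by (simp add: card_PiE numeral_2_eq_2)
  have "squares T (carrier T) = {\<lambda>i\<in>{..<\<gamma>}. 0} \<times> ({..<\<delta>} \<rightarrow>\<^sub>E {0, 2})"
  proof (intro equalityI subsetI)
    fix p assume "p \<in> squares T (carrier T)"
    then obtain a b where ab: "a \<in> carrier (Zmod_power 2 \<gamma>)" "b \<in> carrier (Zmod_power 4 \<delta>)"
      "p = ((\<lambda>i\<in>{..<\<gamma>}. (a i + a i) mod 2), (\<lambda>i\<in>{..<\<delta>}. (b i + b i) mod 4))"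
      by (auto simp: squares_def T_def mult_Zmod_power)
    have "(x + x) mod 4 = 0 \<or> (x + x) mod 4 = 2" for x :: int by presburger
    then show "p \<in> {\<lambda>i\<in>{..<\<gamma>}. 0} \<times> ({..<\<delta>} \<rightarrow>\<^sub>E {0, 2})"
      unfolding ab by (auto intro!: restrict_ext)
  next
    fix p assume "p \<in> {\<lambda>i\<in>{..<\<gamma>}. 0::int} \<times> ({..<\<delta>} \<rightarrow>\<^sub>E {0, 2::int})"
    then obtain b where b: "p = (\<lambda>i\<in>{..<\<gamma>}. 0, b)" "b \<in> {..<\<delta>} \<rightarrow>\<^sub>E {0, 2}" by auto
    \<comment> \<open>A preimage under doubling: the entries of \<open>b\<close> are 0 or 2 and can
      be halved.\<close>
    let ?a = "\<lambda>i\<in>{..<\<gamma>}. 0::int" and ?c = "\<lambda>i\<in>{..<\<delta>}. b i div 2"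
    have bi: "b i = 0 \<or> b i = 2" if "i < \<delta>" for i using b that by (auto simp: PiE_iff)
    have half: "b i = 2 * (b i div 2) mod 4 \<and> 0 \<le> b i div 2 \<and> b i div 2 < 4" if "i < \<delta>" for i
      using bi[OF that] by auto
    have "b = (\<lambda>i\<in>{..<\<delta>}. (?c i + ?c i) mod 4)"
      using b half by (intro extensionalityI[of b "{..<\<delta>}"]) (auto simp: PiE_iff)
    moreover have "?a = (\<lambda>i\<in>{..<\<gamma>}. (?a i + ?a i) mod 2)" by auto
    ultimately have "p = (?a, ?c) \<otimes>\<^bsub>T\<^esub> (?a, ?c)"
      unfolding b T_def mult_DirProd mult_Zmod_power of_nat_numeral by blast
    moreover have "?c \<in> carrier (Zmod_power 4 \<delta>)"
      using half by (auto simp: carrier_Zmod_power)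
    moreover have "?a \<in> carrier (Zmod_power 2 \<gamma>)" by (auto simp: carrier_Zmod_power)
    ultimately show "p \<in> squares T (carrier T)"
      unfolding squares_def by (intro image_eqI[of _ _ "(?a, ?c)"]) (auto simp: T_def)
  qed
  then show "card (squares T (carrier T)) = 2 ^ \<delta>"
    by (simp add: card_cartesian_product two)
  have even: "x + x = 0 \<or> (x + x) mod 4 = 0 \<longleftrightarrow> x = 0 \<or> x = 2" if "0 \<le> x" "x < 4" for x :: int
    using that by presburger
  have "two_torsion T (carrier T) = carrier (Zmod_power 2 \<gamma>) \<times> ({..<\<delta>} \<rightarrow>\<^sub>E {0, 2})"
  proof (intro equalityI subsetI)
    fix p assume "p \<in> two_torsion T (carrier T)"
    then obtain a b where ab: "p = (a, b)" "a \<in> carrier (Zmod_power 2 \<gamma>)" "b \<in> carrier (Zmod_power 4 \<delta>)"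
      "(\<lambda>i\<in>{..<\<delta>}. (b i + b i) mod 4) = (\<lambda>i\<in>{..<\<delta>}. 0)"
      by (auto simp: two_torsion_def T_def mult_Zmod_power one_Zmod_power DirProd_def)
    have "b i = 0 \<or> b i = 2" if "i < \<delta>" for i
      using fun_cong[OF ab(4), of i] ab(3) that even[of "b i"] by (auto simp: carrier_Zmod_power PiE_iff)
    then show "p \<in> carrier (Zmod_power 2 \<gamma>) \<times> ({..<\<delta>} \<rightarrow>\<^sub>E {0, 2})"
      using ab by (auto simp: carrier_Zmod_power PiE_iff)
  next
    fix p assume "p \<in> carrier (Zmod_power 2 \<gamma>) \<times> ({..<\<delta>} \<rightarrow>\<^sub>E {0, 2::int})"
    then obtain a b where ab: "p = (a, b)" "a \<in> carrier (Zmod_power 2 \<gamma>)" "b \<in> {..<\<delta>} \<rightarrow>\<^sub>E {0, 2}"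
      by auto
    have bi: "0 \<le> b i \<and> b i < 4 \<and> (b i + b i) mod 4 = 0" if "i < \<delta>" for i
      using PiE_mem[OF ab(3), of i] that by auto
    have "b \<in> carrier (Zmod_power 4 \<delta>)"
      using ab(3) bi by (auto simp: carrier_Zmod_power PiE_iff)
    moreover have "(a i + a i) mod 2 = 0" for i by presburger
    then have "(\<lambda>i\<in>{..<\<gamma>}. (a i + a i) mod 2) = (\<lambda>i\<in>{..<\<gamma>}. 0)" by (intro restrict_ext)
    moreover have "(\<lambda>i\<in>{..<\<delta>}. (b i + b i) mod 4) = (\<lambda>i\<in>{..<\<delta>}. 0)"
      using bi by (intro restrict_ext) blast
    ultimately show "p \<in> two_torsion T (carrier T)"
      using ab(2) unfolding ab(1) two_torsion_def T_def one_DirProd mem_Collect_eq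
      by (simp only: mult_DirProd mult_Zmod_power one_Zmod_power of_nat_numeral) (simp add: DirProd_def)
  qed
  then show "card (two_torsion T (carrier T)) = 2 ^ (\<gamma> + \<delta>)"
    by (simp add: card_cartesian_product two card_carrier_Zmod_power power_add)
qed

text \<open>These cardinalities depend only on the group structure, so the isomorphism in
  \<open>of_type\<close> carries them over from the standard group. The last two recover \<delta>
  and \<gamma> + \<delta>.\<close>

lemma of_type_card:
  assumes "of_type n \<gamma> \<delta> C"
  shows "card C = 2 ^ (\<gamma> + 2 * \<delta>)"
    and "card (squares (Zmod_power 4 n) C) = 2 ^ \<delta>"
    and "card (two_torsion (Zmod_power 4 n) C) = 2 ^ (\<gamma> + \<delta>)"
proof -
  let ?G = "Zmod_power 4 n" and ?T = "Zmod_power 2 \<gamma> \<times>\<times> Zmod_power 4 \<delta>"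
  have C: "subgroup C ?G" and iso: "?G\<lparr>carrier := C\<rparr> \<cong> ?T"
    using assms by (auto simp: of_type_def quaternary_linear_code_def)
  have "group (?G\<lparr>carrier := C\<rparr>)"
    using C group_Zmod_power by (rule subgroup.subgroup_is_group)
  moreover have "group ?T" by (intro DirProd_group group_Zmod_power)
  ultimately have "card C = card (carrier ?T)"
    "card (squares ?G C) = card (squares ?T (carrier ?T))"
    "card (two_torsion ?G C) = card (two_torsion ?T (carrier ?T))"
    using iso_card_squares_two_torsion[OF _ _ iso] by (simp_all add: squares_def two_torsion_def)
  then show "card C = 2 ^ (\<gamma> + 2 * \<delta>)" "card (squares ?G C) = 2 ^ \<delta>"
    "card (two_torsion ?G C) = 2 ^ (\<gamma> + \<delta>)"
    by (simp_all only: card_standard_type)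
qed

section \<open>Every quaternary linear code has a type\<close>

text \<open>For words with even entries this is linear independence over the field with two
  elements: their combinations depend only on the parities of the coefficients.\<close>

definition indep2 :: "nat \<Rightarrow> nat \<Rightarrow> (nat \<Rightarrow> nat \<Rightarrow> int) \<Rightarrow> bool" where
  "indep2 n k y \<longleftrightarrow> (\<forall>a. lincomb n k a y = \<one>\<^bsub>Zmod_power 4 n\<^esub> \<longrightarrow> (\<forall>j<k. even (a j)))"

text \<open>The sums over the \<open>2 ^ k\<close> subsets of the family are distinct. The crude
  bound is enough to make a longest independent family exist.\<close>

lemma indep2_le_card:
  assumes E: "subgroup E (Zmod_power 4 n)" and y: "\<And>j. j < k \<Longrightarrow> y j \<in> E" and ind: "indep2 n k y"
  shows "k \<le> card E"
proof -
  let ?a = "\<lambda>S j. of_bool (j \<in> S) :: int"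
  have "inj_on (\<lambda>S. lincomb n k (?a S) y) (Pow {..<k})"
  proof (rule inj_onI)
    fix S T assume ST: "S \<in> Pow {..<k}" "T \<in> Pow {..<k}"
      and eq: "lincomb n k (?a S) y = lincomb n k (?a T) y"
    have "lincomb n k (\<lambda>j. ?a S j - ?a T j) y = \<one>\<^bsub>Zmod_power 4 n\<^esub>"
      using eq unfolding lincomb_eq_iff lincomb_eq_one_iff
      by (simp add: algebra_simps sum_subtractf mod_eq_dvd_iff mod_eq_0_iff_dvd)
    then have "even (?a S j - ?a T j)" if "j < k" for j
      using ind that unfolding indep2_def by blast
    \<comment> \<open>The difference of two indicator values is -1, 0 or 1, so it vanishes when
      even.\<close>
    then have "j \<in> S \<longleftrightarrow> j \<in> T" if "j < k" for j
      using that by (fastforce split: if_splits)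
    then show "S = T" using ST by auto
  qed
  moreover have "(\<lambda>S. lincomb n k (?a S) y) ` Pow {..<k} \<subseteq> E"
    using lincomb_closed[OF E y] by auto
  ultimately have "card (Pow {..<k}) \<le> card E"
    using finite_code[OF E] by (intro card_inj_on_le)
  then have "2 ^ k \<le> card E" by (simp add: card_Pow)
  then show ?thesis by (meson le_trans less_exp less_imp_le)
qed

text \<open>In a relation, an odd coefficient of \<open>e\<close> would express \<open>e\<close>
  through the old words; an even one contributes 0 modulo 4 and leaves a relation among the old
  words.\<close>

lemma indep2_extend:
  assumes ind: "indep2 n k y" and even: "\<And>i. i < n \<Longrightarrow> even (e i)" and e: "e \<in> carrier (Zmod_power 4 n)"
    and new: "\<And>a. e \<noteq> lincomb n k a y"
  shows "indep2 n (Suc k) (y(k := e))"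
  unfolding indep2_def
proof (intro allI impI)
  fix a j assume eq: "lincomb n (Suc k) a (y(k := e)) = \<one>\<^bsub>Zmod_power 4 n\<^esub>" and j: "j < Suc k"
  have sum: "((\<Sum>j<k. a j * y j i) + a k * e i) mod 4 = 0" if "i < n" for i
    using eq that unfolding lincomb_eq_one_iff by simp
  have "even (a k)"
  proof (rule ccontr)
    assume "odd (a k)"
    then obtain b where b: "a k = 2 * b + 1" by (elim oddE)
    have "e i = (\<Sum>j<k. a j * y j i) mod 4" if i: "i < n" for i
    proof -
      obtain f where f: "e i = 2 * f" using even[OF i] by (elim evenE)
      have "((\<Sum>j<k. a j * y j i) + (4 * (b * f) + 2 * f)) mod 4 = 0"
        using sum[OF i] by (simp add: b f algebra_simps)
      \<comment> \<open>Since \<open>2 * f\<close> and \<open>- 2 * f\<close> agree modulo 4,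
        solving for \<open>e i\<close> introduces no sign.\<close>
      moreover have "0 \<le> e i" "e i < 4"
        using e i by (auto simp: carrier_Zmod_power PiE_iff)
      ultimately show ?thesis unfolding f by presburger
    qed
    then have "e = lincomb n k a y"
      using e by (intro extensionalityI[of _ "{..<n}"]) (auto simp: lincomb_def carrier_Zmod_power PiE_iff)
    with new show False by blast
  qed
  moreover have "even (a j)" if "j < k"
  proof -
    have "(\<Sum>j<k. a j * y j i) mod 4 = 0" if i: "i < n" for i
    proof -
      obtain f b where "e i = 2 * f" "a k = 2 * b"
        using even[OF i] \<open>even (a k)\<close> by (elim evenE) blast
      then have "a k * e i = 4 * (b * f)" by simp
      then show ?thesis using sum[OF i] by simp
    qed
    then show ?thesis using ind that unfolding indep2_def lincomb_eq_one_iff by blast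
  qed
  ultimately show "even (a j)" using j by (cases "j = k") auto
qed

text \<open>An independent family in \<open>E\<close> that extends \<open>y\<close> and has greatest
  length spans \<open>E\<close>, as otherwise a word outside its span could be appended.\<close>

lemma indep2_extend_to_basis:
  assumes E: "subgroup E (Zmod_power 4 n)" and even: "\<And>x i. x \<in> E \<Longrightarrow> i < n \<Longrightarrow> even (x i)"
    and y: "\<And>j. j < k \<Longrightarrow> y j \<in> E" and ind: "indep2 n k y"
  obtains m z where "k \<le> m" "\<And>j. j < k \<Longrightarrow> z j = y j" "\<And>j. j < m \<Longrightarrow> z j \<in> E" "indep2 n m z"
    "\<And>e. e \<in> E \<Longrightarrow> \<exists>a. e = lincomb n m a z"
proof -
  define P where "P m \<longleftrightarrow> (\<exists>z. k \<le> m \<and> (\<forall>j<k. z j = y j) \<and> (\<forall>j<m. z j \<in> E) \<and> indep2 n m z)" for m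
  have "P k" using y ind by (auto simp: P_def)
  have bound: "m \<le> card E" if "P m" for m
    using that indep2_le_card[OF E] unfolding P_def by blast
  have "P (Greatest P)" by (rule GreatestI_nat[where P = P, OF \<open>P k\<close> bound])
  then obtain z where z: "k \<le> Greatest P" "\<And>j. j < k \<Longrightarrow> z j = y j" "\<And>j. j < Greatest P \<Longrightarrow> z j \<in> E"
    "indep2 n (Greatest P) z" unfolding P_def by blast
  have "\<exists>a. e = lincomb n (Greatest P) a z" if e: "e \<in> E" for e
  proof (rule ccontr)
    assume "\<not> ?thesis"
    then have "indep2 n (Suc (Greatest P)) (z(Greatest P := e))"
      using indep2_extend[OF z(4)] even[OF e] subgroup.mem_carrier[OF E e] by blast
    then have "P (Suc (Greatest P))"
      using z(1-3) e by (subst P_def) (intro exI[of _ "z(Greatest P := e)"], auto simp: less_Suc_eq)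
    then have "Suc (Greatest P) \<le> Greatest P"
      by (rule Greatest_le_nat[where P = P, OF _ bound])
    then show False by simp
  qed
  with z show thesis using that by blast
qed

lemma even_two_torsion:
  assumes "x \<in> two_torsion (Zmod_power 4 n) C" "i < n"
  shows "even (x i)"
proof -
  have "(x i + x i) mod 4 = 0"
    using assms by (auto simp: two_torsion_def mult_Zmod_power one_Zmod_power fun_eq_iff restrict_def)
       metis
  then show ?thesis by presburger
qed

text \<open>Four times any word is the zero word.\<close>

lemma square_two_torsion:
  assumes "subgroup C (Zmod_power 4 n)"
  shows "squares (Zmod_power 4 n) C \<subseteq> two_torsion (Zmod_power 4 n) C"
proof -
  have "(x + x) mod 4 + (x + x) mod 4 = 0 \<or> ((x + x) mod 4 + (x + x) mod 4) mod 4 = 0" for x :: int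
    by presburger
  then have "((x + x) mod 4 + (x + x) mod 4) mod 4 = 0" for x :: int
    by presburger
  then show ?thesis
    using subgroup.m_closed[OF assms]
    by (auto simp: squares_def two_torsion_def) (auto simp: mult_Zmod_power one_Zmod_power intro!: restrict_ext)
qed

text \<open>
  A basis \<open>2x\<^sub>1, \<dots>, 2x\<^sub>\<delta>\<close> of the \<open>\<bbbF>\<^sub>2\<close>-space \<open>2C\<close>, extended by \<open>y\<^sub>1, \<dots>, y\<^sub>\<gamma>\<close> to a basis of the
  2-torsion of \<open>C\<close>, yields generators of the cyclic factors: the \<open>x\<^sub>j\<close> have order 4, the \<open>y\<^sub>k\<close> order 2.
\<close>

lemma of_type_exists:
  assumes C: "subgroup C (Zmod_power 4 n)"
  obtains \<gamma> \<delta> where "of_type n \<gamma> \<delta> C"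
proof -
  let ?G = "Zmod_power 4 n"
  interpret comm_group ?G by (rule comm_group_Zmod_power)
  let ?S = "squares ?G C" and ?E = "two_torsion ?G C"
  have S: "subgroup ?S ?G" using C by (rule subgroup_squares)
  have E: "subgroup ?E ?G" using C by (rule subgroup_two_torsion)
  have SE: "?S \<subseteq> ?E" using C by (rule square_two_torsion)
  \<comment> \<open>The empty family is extended here; the family supplied at length 0 is a
    dummy.\<close>
  obtain \<delta> z where z: "\<And>j. j < \<delta> \<Longrightarrow> z j \<in> ?S" "indep2 n \<delta> z" "\<And>e. e \<in> ?S \<Longrightarrow> \<exists>a. e = lincomb n \<delta> a z"
    by (rule indep2_extend_to_basis[OF S, of 0 "\<lambda>_ _. 0"])
       (use SE even_two_torsion in \<open>auto simp: indep2_def\<close>)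
  obtain m w where w: "\<delta> \<le> m" "\<And>j. j < \<delta> \<Longrightarrow> w j = z j" "\<And>j. j < m \<Longrightarrow> w j \<in> ?E" "indep2 n m w"
    "\<And>e. e \<in> ?E \<Longrightarrow> \<exists>a. e = lincomb n m a w"
    by (rule indep2_extend_to_basis[OF E, of \<delta> z]) (use SE z(1,2) even_two_torsion in auto)
  have "\<forall>j. \<exists>x. j < \<delta> \<longrightarrow> x \<in> C \<and> z j = x \<otimes>\<^bsub>?G\<^esub> x"
    using z(1) by (auto simp: squares_def)
  then obtain x where x: "\<And>j. j < \<delta> \<Longrightarrow> x j \<in> C" "\<And>j. j < \<delta> \<Longrightarrow> z j = x j \<otimes>\<^bsub>?G\<^esub> x j"
    by metis
  define \<gamma> where "\<gamma> = m - \<delta>"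
  \<comment> \<open>The members of the basis \<open>w\<close> after the first \<delta>, which are
    those of \<open>z\<close>.\<close>
  define y where "y k = w (\<delta> + k)" for k
  have y: "y k \<in> ?E" if "k < \<gamma>" for k using w that by (auto simp: y_def \<gamma>_def)
  have yC: "y k \<in> C" if "k < \<gamma>" for k using y[OF that] by (auto simp: two_torsion_def)
  have y_even: "even (y k i)" if "k < \<gamma>" "i < n" for k i
    using even_two_torsion[OF y] that by blast
  have split: "lincomb n m a w = lincomb n \<delta> a z \<otimes>\<^bsub>?G\<^esub> lincomb n \<gamma> (\<lambda>k. a (\<delta> + k)) y" for a
  proof -
    have "(\<Sum>j<\<delta>+\<gamma>. a j * w j i) = (\<Sum>j<\<delta>. a j * z j i) + (\<Sum>k<\<gamma>. a (\<delta> + k) * y k i)" for i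
    proof -
      have "(\<Sum>j<\<delta>+l. a j * w j i) = (\<Sum>j<\<delta>. a j * w j i) + (\<Sum>k<l. a (\<delta> + k) * w (\<delta> + k) i)" for l
        by (induction l) auto
      then show ?thesis by (simp add: y_def w(2))
    qed
    moreover have "m = \<delta> + \<gamma>" using w(1) by (simp add: \<gamma>_def)
    ultimately show ?thesis
      by (auto simp: lincomb_def mult_Zmod_power mod_simps intro!: restrict_ext)
  qed
  have double: "lincomb n \<delta> b z = lincomb n \<delta> (\<lambda>j. 2 * b j) x" for b
    by (intro lincomb_cong) (simp add: x(2) mult_Zmod_power mod_simps ac_simps)

  \<comment> \<open>The future isomorphism, with its arguments ordered as in \<open>?T\<close>. It
    accepts all integer coefficients: additivity is clear for unreduced sums (\<open>F_add\<close>),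
    and \<open>red\<close> brings these into the carrier of \<open>?T\<close>, modulo 2 on
    \<open>y\<close> because these words are even.\<close>
  define F where "F = (\<lambda>(a, b). lincomb n \<delta> b x \<otimes>\<^bsub>?G\<^esub> lincomb n \<gamma> a y)"
  let ?T = "Zmod_power 2 \<gamma> \<times>\<times> Zmod_power 4 \<delta>"
  have car: "lincomb n \<delta> b x \<in> C" "lincomb n \<gamma> a y \<in> C" for a b
    using lincomb_closed[OF C] x(1) yC by auto
  have car': "lincomb n \<delta> b x \<in> carrier ?G" "lincomb n \<gamma> a y \<in> carrier ?G" for a b
    using car subgroup.mem_carrier[OF C] by auto
  have red: "F (\<lambda>k\<in>{..<\<gamma>}. a k mod 2, \<lambda>j\<in>{..<\<delta>}. b j mod 4) = F (a, b)" for a b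
  proof -
    have "lincomb n \<delta> (\<lambda>j\<in>{..<\<delta>}. b j mod 4) x = lincomb n \<delta> b x"
      by (intro lincomb_cong) (simp add: mod_simps)
    moreover have "lincomb n \<gamma> (\<lambda>k\<in>{..<\<gamma>}. a k mod 2) y = lincomb n \<gamma> a y"
    proof (intro lincomb_cong)
      fix i k assume "i < n" "k < \<gamma>"
      then obtain f where f: "y k i = 2 * f" using y_even by blast
      have "a k mod 2 = a k - 2 * (a k div 2)" by presburger
      then have "a k mod 2 * (2 * f) - a k * (2 * f) = 4 * (- (f * (a k div 2)))"
        by (simp only:) (simp add: left_diff_distrib)
      then show "(\<lambda>k\<in>{..<\<gamma>}. a k mod 2) k * y k i mod 4 = a k * y k i mod 4"
        using \<open>k < \<gamma>\<close> unfolding f mod_eq_dvd_iff by (metis dvd_triv_left lessThan_iff restrict_apply')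
    qed
    ultimately show ?thesis by (simp add: F_def)
  qed
  have F_add: "F (\<lambda>k. a k + a' k, \<lambda>j. b j + b' j) = F (a, b) \<otimes>\<^bsub>?G\<^esub> F (a', b')" for a a' b b'
    using car' by (simp add: F_def m_ac flip: lincomb_add)
  have hom: "F \<in> hom ?T (?G\<lparr>carrier := C\<rparr>)"
  proof (rule homI)
    fix p assume "p \<in> carrier ?T"
    show "F p \<in> carrier (?G\<lparr>carrier := C\<rparr>)"
      using car subgroup.m_closed[OF C] by (auto simp: F_def split: prod.split)
  next
    fix p q assume "p \<in> carrier ?T" "q \<in> carrier ?T"
    show "F (p \<otimes>\<^bsub>?T\<^esub> q) = F p \<otimes>\<^bsub>?G\<lparr>carrier := C\<rparr>\<^esub> F q"
      using red[of "\<lambda>k. fst p k + fst q k" "\<lambda>j. snd p j + snd q j"] F_add[of "fst p" "fst q" "snd p" "snd q"]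
      by (cases p; cases q) (simp add: mult_Zmod_power)
  qed
  interpret F: group_hom ?T "?G\<lparr>carrier := C\<rparr>" F
    unfolding group_hom_def group_hom_axioms_def
    using hom C by (auto intro!: DirProd_group group_Zmod_power subgroup.subgroup_is_group)
  have "F ` carrier ?T = C"
  proof (intro equalityI subsetI)
    show "d \<in> C" if "d \<in> F ` carrier ?T" for d
      using that F.hom_closed by auto
    fix d assume d: "d \<in> C"
    then have dG: "d \<in> carrier ?G" by (rule subgroup.mem_carrier[OF C])
    \<comment> \<open>A combination \<open>?u\<close> of the \<open>x j\<close> is found with the
      same double as \<open>d\<close>. The difference is then 2-torsion and expands in
      \<open>w\<close>; its \<open>z\<close> part is a combination of the \<open>x j\<close> with
      coefficients \<open>2 * a j\<close>.\<close>
    obtain b where b: "d \<otimes>\<^bsub>?G\<^esub> d = lincomb n \<delta> b z" using z(3) d by (auto simp: squares_def)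
    let ?u = "lincomb n \<delta> b x"
    have "d \<otimes>\<^bsub>?G\<^esub> d = ?u \<otimes>\<^bsub>?G\<^esub> ?u" unfolding b double lincomb_add by simp
    moreover have "(d \<otimes>\<^bsub>?G\<^esub> inv\<^bsub>?G\<^esub> ?u) \<otimes>\<^bsub>?G\<^esub> (d \<otimes>\<^bsub>?G\<^esub> inv\<^bsub>?G\<^esub> ?u) =
        (d \<otimes>\<^bsub>?G\<^esub> d) \<otimes>\<^bsub>?G\<^esub> inv\<^bsub>?G\<^esub> (?u \<otimes>\<^bsub>?G\<^esub> ?u)"
      using dG car' by (simp add: inv_mult m_ac)
    ultimately have "d \<otimes>\<^bsub>?G\<^esub> inv\<^bsub>?G\<^esub> ?u \<in> ?E"
      using d car car' subgroup.m_closed[OF C] subgroup.m_inv_closed[OF C] by (simp add: two_torsion_def)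
    then obtain a where "d \<otimes>\<^bsub>?G\<^esub> inv\<^bsub>?G\<^esub> ?u = lincomb n m a w" using w(5) by blast
    then have "d \<otimes>\<^bsub>?G\<^esub> inv\<^bsub>?G\<^esub> ?u = F (\<lambda>k. a (\<delta> + k), \<lambda>j. 2 * a j)"
      unfolding split double F_def by simp
    then have "d = F (\<lambda>k. a (\<delta> + k), \<lambda>j. 2 * a j) \<otimes>\<^bsub>?G\<^esub> ?u"
      using dG car' by (metis inv_closed inv_solve_right' m_closed inv_solve_right)
    also have "?u = F (\<lambda>_. 0, b)"
      using car' by (simp add: F_def lincomb_zero)
    finally have "d = F (\<lambda>k. a (\<delta> + k) + 0, \<lambda>j. 2 * a j + b j)"
      unfolding F_add .
    then have "d = F (\<lambda>k\<in>{..<\<gamma>}. (a (\<delta> + k) + 0) mod 2, \<lambda>j\<in>{..<\<delta>}. (2 * a j + b j) mod 4)"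
      unfolding red .
    moreover have "(\<lambda>k\<in>{..<\<gamma>}. (a (\<delta> + k) + 0) mod 2, \<lambda>j\<in>{..<\<delta>}. (2 * a j + b j) mod 4) \<in> carrier ?T"
      by (auto simp: carrier_Zmod_power)
    ultimately show "d \<in> F ` carrier ?T" by blast
  qed
  moreover have "inj_on F (carrier ?T)"
  proof -
    have "p = \<one>\<^bsub>?T\<^esub>" if p: "p \<in> carrier ?T" and 1: "F p = \<one>\<^bsub>?G\<^esub>" for p
    proof -
      obtain a b where ab: "p = (a, b)" "a \<in> carrier (Zmod_power 2 \<gamma>)" "b \<in> carrier (Zmod_power 4 \<delta>)"
        using p by (auto simp: DirProd_def)
      \<comment> \<open>Doubling \<open>F p\<close> removes the \<open>a\<close> part and leaves a
        combination of the independent words \<open>z j\<close>, so every \<open>b j\<close> is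
        even.\<close>
      have F2: "F (\<lambda>k. a k + a k, \<lambda>j. b j + b j) = \<one>\<^bsub>?G\<^esub>"
        unfolding F_add using 1 ab by simp
      have "F (\<lambda>k. a k + a k, \<lambda>j. b j + b j) = F (\<lambda>_. 0, \<lambda>j. 2 * b j)"
        by (subst (1 2) red[symmetric]) (simp flip: mult_2)
      also have "\<dots> = lincomb n \<delta> b z"
        using car' by (simp add: F_def double lincomb_zero)
      finally have "lincomb n \<delta> b z = \<one>\<^bsub>?G\<^esub>" using F2 by simp
      then have b_even: "even (b j)" if "j < \<delta>" for j
        using z(2) that unfolding indep2_def by blast
      \<comment> \<open>With \<open>b j\<close> even, \<open>F p\<close> itself is a combination of
        the \<open>w j\<close>, with \<open>b j div 2\<close> on \<open>z\<close> and
        \<open>a\<close> on \<open>y\<close>. Independence makes these coefficients even, and the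
        ranges of \<open>a\<close> and \<open>b\<close> leave only 0.\<close>
      define c where "c j = (if j < \<delta> then b j div 2 else a (j - \<delta>))" for j
      have "lincomb n \<delta> c z = lincomb n \<delta> b x"
        unfolding double by (intro lincomb_cong) (simp add: c_def b_even)
      then have "lincomb n m c w = F p"
        unfolding split ab F_def by (simp add: c_def)
      then have c_even: "even (c j)" if "j < m" for j
        using w(4) 1 that unfolding indep2_def by simp
      have "a k = 0" if "k < \<gamma>" for k
      proof -
        have "even (a k)" using c_even[of "\<delta> + k"] that by (simp add: c_def \<gamma>_def)
        moreover have "0 \<le> a k" "a k < 2" using ab(2) that by (auto simp: carrier_Zmod_power PiE_iff)
        ultimately show ?thesis by presburger
      qed
      moreover have "b j = 0" if "j < \<delta>" for j
      proof -
        have "even (b j div 2)" using c_even[of j] that w(1) by (simp add: c_def)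
        moreover have "0 \<le> b j" "b j < 4" using ab(3) that by (auto simp: carrier_Zmod_power PiE_iff)
        ultimately show ?thesis using b_even[OF that] by presburger
      qed
      ultimately have "a = (\<lambda>k\<in>{..<\<gamma>}. 0)" "b = (\<lambda>j\<in>{..<\<delta>}. 0)"
        using ab by (auto intro!: extensionalityI[of a "{..<\<gamma>}"] extensionalityI[of b "{..<\<delta>}"]
            simp: carrier_Zmod_power PiE_iff)
      then show ?thesis by (simp add: ab one_Zmod_power DirProd_def)
    qed
    then show ?thesis
      using F.inj_on_one_iff by simp
  qed
  ultimately have "F \<in> iso ?T (?G\<lparr>carrier := C\<rparr>)"
    using hom by (simp add: iso_iff)
  then have "?G\<lparr>carrier := C\<rparr> \<cong> ?T"
    by (meson F.G.iso_sym is_isoI)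
  then show thesis
    using that C by (auto simp: of_type_def quaternary_linear_code_def)
qed

section \<open>Duality\<close>

text \<open>Kept as an integer so that it can serve as an exponent of \<open>\<i>\<close>; reduction
  modulo 4 is imposed where it is used.\<close>

definition dot :: "nat \<Rightarrow> (nat \<Rightarrow> int) \<Rightarrow> (nat \<Rightarrow> int) \<Rightarrow> int" where
  "dot n u v = (\<Sum>j<n. u j * v j)"

lemma dot_commute: "dot n u v = dot n v u"
  by (simp add: dot_def mult.commute)

lemma dot_mult: "dot n u (v \<otimes>\<^bsub>Zmod_power 4 n\<^esub> w) mod 4 = (dot n u v + dot n u w) mod 4"
proof -
  have "dot n u (v \<otimes>\<^bsub>Zmod_power 4 n\<^esub> w) mod 4 = (\<Sum>j<n. u j * ((v j + w j) mod 4)) mod 4"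
    by (simp add: dot_def mult_Zmod_power)
  also have "\<dots> = (\<Sum>j<n. u j * (v j + w j)) mod 4"
    by (subst (1 2) mod_sum_eq[symmetric]) (simp add: mod_mult_right_eq)
  finally show ?thesis by (simp add: dot_def sum.distrib distrib_left)
qed

lemma dot_one: "dot n u \<one>\<^bsub>Zmod_power 4 n\<^esub> = 0" "dot n \<one>\<^bsub>Zmod_power 4 n\<^esub> u = 0"
  by (simp_all add: dot_def one_Zmod_power)

lemma dual_code_eq:
  "dual_code n C = {u \<in> carrier (Zmod_power 4 n). \<forall>v\<in>C. dot n v u mod 4 = 0}"
  by (simp add: dual_code_def dot_def mult.commute)

lemma subgroup_dual_code: "subgroup (dual_code n C) (Zmod_power 4 n)"
proof -
  let ?G = "Zmod_power 4 n"
  interpret comm_group ?G by (rule comm_group_Zmod_power)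
  show ?thesis
  proof (rule subgroupI)
    show "dual_code n C \<subseteq> carrier ?G" by (auto simp: dual_code_def)
    have "\<one>\<^bsub>?G\<^esub> \<in> dual_code n C" by (auto simp: dual_code_eq dot_one)
    then show "dual_code n C \<noteq> {}" by blast
    show "inv\<^bsub>?G\<^esub> a \<in> dual_code n C" if "a \<in> dual_code n C" for a
    proof -
      have "dot n v (inv\<^bsub>?G\<^esub> a) mod 4 = 0" if "v \<in> C" for v
      proof -
        have "(dot n v a + dot n v (inv\<^bsub>?G\<^esub> a)) mod 4 = 0"
          using \<open>a \<in> dual_code n C\<close> by (simp add: dual_code_eq dot_one flip: dot_mult)
        moreover have "dot n v a mod 4 = 0"
          using \<open>a \<in> dual_code n C\<close> that by (simp add: dual_code_eq)
        ultimately show ?thesis by presburger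
      qed
      then show ?thesis using that by (simp add: dual_code_eq)
    qed
    show "a \<otimes>\<^bsub>?G\<^esub> b \<in> dual_code n C" if ab: "a \<in> dual_code n C" "b \<in> dual_code n C" for a b
    proof -
      have "dot n v (a \<otimes>\<^bsub>?G\<^esub> b) mod 4 = 0" if "v \<in> C" for v
      proof -
        have "dot n v a mod 4 = 0" "dot n v b mod 4 = 0"
          using ab that by (auto simp: dual_code_eq)
        then show ?thesis unfolding dot_mult by presburger
      qed
      then show ?thesis using ab by (simp add: dual_code_eq)
    qed
  qed
qed

section \<open>Character sums and the double dual\<close>

lemma i_powi_mod_4: "\<i> powi (k mod 4) = \<i> powi k"
proof -
  have "\<i> powi k = \<i> powi (4 * (k div 4) + k mod 4)" by simp
  also have "\<dots> = (\<i> powi 4) powi (k div 4) * \<i> powi (k mod 4)"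
    by (simp only: power_int_add power_int_mult complex_i_not_zero simp_thms)
  also have "\<i> powi 4 = 1" by simp
  finally show ?thesis by simp
qed

lemma i_powi_eq_1_iff: "\<i> powi k = 1 \<longleftrightarrow> k mod 4 = 0"
proof -
  have "k mod 4 = 0 \<or> k mod 4 = 1 \<or> k mod 4 = 2 \<or> k mod 4 = 3" by presburger
  then have "\<i> powi (k mod 4) = 1 \<longleftrightarrow> k mod 4 = 0"
    by (elim disjE) (auto simp: power3_eq_cube complex_eq_iff)
  then show ?thesis by (simp only: i_powi_mod_4)
qed

text \<open>Orthogonality of characters: translation by a \<open>w\<close> in \<open>C\<close> with
  a nontrivial value permutes \<open>C\<close> but multiplies the sum by that value, which forces
  the sum to be 0.\<close>

lemma sum_character_code:
  assumes C: "subgroup C (Zmod_power 4 n)"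
  shows "(\<Sum>v\<in>C. \<i> powi dot n u v) = (if \<forall>v\<in>C. dot n u v mod 4 = 0 then of_nat (card C) else 0)"
proof (cases "\<forall>v\<in>C. dot n u v mod 4 = 0")
  case True
  then have "(\<Sum>v\<in>C. \<i> powi dot n u v) = (\<Sum>v\<in>C. 1)"
    by (intro sum.cong refl) (simp add: i_powi_eq_1_iff)
  with True show ?thesis by simp
next
  case False
  let ?G = "Zmod_power 4 n"
  interpret comm_group ?G by (rule comm_group_Zmod_power)
  interpret C: subgroup C ?G by fact
  from False obtain w where w: "w \<in> C" "\<i> powi dot n u w \<noteq> 1"
    by (auto simp: i_powi_eq_1_iff)
  have "bij_betw (\<lambda>v. w \<otimes>\<^bsub>?G\<^esub> v) C C"
    by (rule bij_betw_byWitness[of _ "\<lambda>v. inv\<^bsub>?G\<^esub> w \<otimes>\<^bsub>?G\<^esub> v"]) (use w in \<open>auto simp flip: m_assoc\<close>)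
  then have "(\<Sum>v\<in>C. \<i> powi dot n u v) = (\<Sum>v\<in>C. \<i> powi dot n u (w \<otimes>\<^bsub>?G\<^esub> v))"
    by (rule sum.reindex_bij_betw[symmetric])
  also have "\<dots> = (\<Sum>v\<in>C. \<i> powi (dot n u w + dot n u v))"
    by (intro sum.cong refl) (metis dot_mult i_powi_mod_4)
  also have "\<dots> = \<i> powi dot n u w * (\<Sum>v\<in>C. \<i> powi dot n u v)"
    by (simp add: power_int_add sum_distrib_left)
  finally have "(\<Sum>v\<in>C. \<i> powi dot n u v) = 0"
    using w(2) by simp
  with False show ?thesis by auto
qed

text \<open>Pairing with unit words reads off the entries of \<open>v\<close>. Hence only the zero
  word induces the trivial character on the whole group.\<close>

lemma dot_nondegenerate:
  assumes v: "v \<in> carrier (Zmod_power 4 n)"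
  shows "(\<forall>u\<in>carrier (Zmod_power 4 n). dot n v u mod 4 = 0) \<longleftrightarrow> v = \<one>\<^bsub>Zmod_power 4 n\<^esub>"
proof
  assume all: "\<forall>u\<in>carrier (Zmod_power 4 n). dot n v u mod 4 = 0"
  have "v i = 0" if i: "i < n" for i
  proof -
    let ?e = "\<lambda>j\<in>{..<n}. of_bool (j = i) :: int"
    have "?e \<in> carrier (Zmod_power 4 n)" by (auto simp: carrier_Zmod_power)
    with all have "dot n v ?e mod 4 = 0" by blast
    moreover have "dot n v ?e = (\<Sum>j<n. if j = i then v i else 0)"
      unfolding dot_def by (intro sum.cong) auto
    moreover have "0 \<le> v i" "v i < 4" using v i by (auto simp: carrier_Zmod_power PiE_iff)
    ultimately show ?thesis using i by simp
  qed
  then show "v = \<one>\<^bsub>Zmod_power 4 n\<^esub>"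
    using v by (intro extensionalityI[of _ "{..<n}"]) (auto simp: carrier_Zmod_power one_Zmod_power PiE_iff)
next
  assume "v = \<one>\<^bsub>Zmod_power 4 n\<^esub>"
  then show "\<forall>u\<in>carrier (Zmod_power 4 n). dot n v u mod 4 = 0"
    by (simp add: dot_one)
qed

text \<open>Double counting of \<open>\<Sum>\<^sub>u \<Sum>\<^sub>v \<i> powi (u \<cdot> v)\<close> over \<open>u\<close> in the whole group and \<open>v \<in> C\<close>.\<close>

lemma card_mult_card_dual_code:
  assumes C: "subgroup C (Zmod_power 4 n)"
  shows "card C * card (dual_code n C) = 4 ^ n"
proof -
  let ?V = "carrier (Zmod_power 4 n)"
  have V: "subgroup ?V (Zmod_power 4 n)" by (rule group.subgroup_self[OF group_Zmod_power])
  have fin: "finite ?V" "finite C" using finite_code[OF V] finite_code[OF C] by auto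
  have CV: "C \<subseteq> ?V" using subgroup.subset[OF C] .
  \<comment> \<open>Summing over \<open>C\<close> first, exactly the words \<open>u\<close> of the
    dual contribute, each \<open>card C\<close>.\<close>
  have "(\<Sum>u\<in>?V. \<Sum>v\<in>C. \<i> powi dot n u v) = (\<Sum>u\<in>?V. if u \<in> dual_code n C then of_nat (card C) else 0)"
    by (intro sum.cong refl) (auto simp: sum_character_code[OF C] dual_code_eq dot_commute)
  also have "\<dots> = of_nat (card C * card (dual_code n C))"
  proof -
    have "?V \<inter> dual_code n C = dual_code n C" by (auto simp: dual_code_def)
    then show ?thesis using fin by (simp add: sum.If_cases)
  qed
  finally have 1: "(\<Sum>u\<in>?V. \<Sum>v\<in>C. \<i> powi dot n u v) = of_nat (card C * card (dual_code n C))" .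
  \<comment> \<open>Summing over the whole group first, only the zero word of \<open>C\<close>
    contributes.\<close>
  have "(\<Sum>u\<in>?V. \<Sum>v\<in>C. \<i> powi dot n u v) = (\<Sum>v\<in>C. \<Sum>u\<in>?V. \<i> powi dot n v u)"
    by (subst sum.swap) (simp add: dot_commute)
  also have "\<dots> = (\<Sum>v\<in>C. if v = \<one>\<^bsub>Zmod_power 4 n\<^esub> then of_nat (card ?V) else 0)"
    using CV by (intro sum.cong refl) (simp add: sum_character_code[OF V] dot_nondegenerate subsetD)
  also have "\<dots> = of_nat (card ?V)"
    using fin subgroup.one_closed[OF C] by simp
  finally have "of_nat (card C * card (dual_code n C)) = (of_nat (card ?V) :: complex)"
    using 1 by simp
  then have "card C * card (dual_code n C) = card ?V" by (simp only: of_nat_eq_iff)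
  then show ?thesis by (simp add: card_carrier_Zmod_power)
qed

text \<open>One inclusion is symmetry of the pairing; the cardinality formula, applied to
  \<open>C\<close> and to its dual, shows that both sides have the same size.\<close>

lemma dual_dual_code:
  assumes C: "subgroup C (Zmod_power 4 n)"
  shows "dual_code n (dual_code n C) = C"
proof -
  let ?D = "dual_code n C" and ?DD = "dual_code n (dual_code n C)"
  have "card C * card ?D = card ?DD * card ?D"
    using card_mult_card_dual_code[OF C] card_mult_card_dual_code[OF subgroup_dual_code[of n C]]
    by (simp add: mult.commute)
  moreover have "card ?D \<noteq> 0"
    using card_mult_card_dual_code[OF C] by (metis mult_0_right power_not_zero zero_neq_numeral)
  ultimately have "card C = card ?DD" by simp
  moreover have "C \<subseteq> ?DD"
    using subgroup.subset[OF C] by (auto simp: dual_code_eq dot_commute)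
  ultimately show ?thesis
    using card_subset_eq[OF finite_code[OF subgroup_dual_code]] by metis
qed

lemma dual_code_set_mult:
  assumes H: "subgroup H (Zmod_power 4 n)" and K: "subgroup K (Zmod_power 4 n)"
  shows "dual_code n (H <#>\<^bsub>Zmod_power 4 n\<^esub> K) = dual_code n H \<inter> dual_code n K"
proof -
  let ?G = "Zmod_power 4 n"
  interpret comm_group ?G by (rule comm_group_Zmod_power)
  have sub: "H \<subseteq> H <#>\<^bsub>?G\<^esub> K" "K \<subseteq> H <#>\<^bsub>?G\<^esub> K"
    using H K by (rule subset_set_mult)+
  have "dot n (h \<otimes>\<^bsub>?G\<^esub> k) u mod 4 = 0" if "dot n h u mod 4 = 0" "dot n k u mod 4 = 0" for h k u
  proof -
    have "(dot n u h + dot n u k) mod 4 = 0" using that unfolding dot_commute[of n _ u] by presburger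
    then show ?thesis unfolding dot_commute[of n _ u] dot_mult .
  qed
  then show ?thesis
    using sub unfolding dual_code_eq by (auto simp: set_mult_def)
qed

text \<open>With \<open>C\<close> and \<open>D\<close> written as double duals, their intersection
  is the dual of the sum of the duals; dualizing once more gives that sum back.\<close>

lemma dual_code_Int:
  assumes C: "subgroup C (Zmod_power 4 n)" and D: "subgroup D (Zmod_power 4 n)"
  shows "dual_code n (C \<inter> D) = dual_code n C <#>\<^bsub>Zmod_power 4 n\<^esub> dual_code n D"
proof -
  have "subgroup (dual_code n C <#>\<^bsub>Zmod_power 4 n\<^esub> dual_code n D) (Zmod_power 4 n)"
    by (intro comm_group.mult_subgroups comm_group_Zmod_power subgroup_dual_code)
  then have "dual_code n (dual_code n (dual_code n C <#>\<^bsub>Zmod_power 4 n\<^esub> dual_code n D)) =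
      dual_code n C <#>\<^bsub>Zmod_power 4 n\<^esub> dual_code n D"
    by (rule dual_dual_code)
  then show ?thesis
    by (simp add: dual_code_set_mult subgroup_dual_code dual_dual_code C D)
qed

section \<open>The intersection of two codes\<close>

theorem theorem6:
  fixes t \<beta> \<gamma>1 \<delta>1 \<gamma>2 \<delta>2 :: nat
    and C1 C2 :: "(nat \<Rightarrow> int) set"
  assumes "t \<ge> 4" and "\<beta> = 2 ^ (t - 1)"
    and "quaternary_linear_perfect_code t C1"
    and "quaternary_linear_perfect_code t C2"
    and "all_ones \<beta> \<in> dual_code \<beta> C1"
    and "all_ones \<beta> \<in> dual_code \<beta> C2"
    and "of_dual_type \<beta> \<gamma>1 \<delta>1 C1"
    and "of_dual_type \<beta> \<gamma>2 \<delta>2 C2"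
  shows "\<exists>\<gamma> \<delta>. of_dual_type \<beta> \<gamma> \<delta> (C1 \<inter> C2) \<and>
           \<delta> \<in> {max \<delta>1 \<delta>2..\<delta>1 + \<delta>2 - 1} \<and>
           max \<delta> (max (\<gamma>1 + \<delta>1) (\<gamma>2 + \<delta>2)) \<le> \<gamma> + \<delta> \<and>
           \<gamma> + \<delta> \<le> \<gamma>1 + \<gamma>2 + \<delta>1 + \<delta>2 - 1"
proof -
  let ?G = "Zmod_power 4 \<beta>" and ?S = "squares (Zmod_power 4 \<beta>)" and ?T = "two_torsion (Zmod_power 4 \<beta>)"
  interpret comm_group ?G by (rule comm_group_Zmod_power)
  define D1 D2 where "D1 = dual_code \<beta> C1" and "D2 = dual_code \<beta> C2"
  let ?D = "D1 <#>\<^bsub>?G\<^esub> D2"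
  have C: "subgroup C1 ?G" "subgroup C2 ?G" and ty: "of_type \<beta> \<gamma>1 \<delta>1 D1" "of_type \<beta> \<gamma>2 \<delta>2 D2"
    using assms(7,8) by (auto simp: of_dual_type_def quaternary_linear_code_def D1_def D2_def)
  have D: "subgroup D1 ?G" "subgroup D2 ?G" unfolding D1_def D2_def by (rule subgroup_dual_code)+
  have D': "subgroup ?D ?G" using D by (rule mult_subgroups)
  have S: "subgroup (?S D1) ?G" "subgroup (?S D2) ?G" using D by (auto intro: subgroup_squares)
  have D_dual: "dual_code \<beta> (C1 \<inter> C2) = ?D"
    unfolding D1_def D2_def using C by (rule dual_code_Int)
  obtain \<gamma> \<delta> where ty': "of_type \<beta> \<gamma> \<delta> ?D" using of_type_exists[OF D'] .
  note card = of_type_card[OF ty(1)] of_type_card[OF ty(2)] of_type_card[OF ty']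
  have fin: "finite D1" "finite D2" "finite ?D" using finite_code D D' by blast+
  have sub: "D1 \<subseteq> ?D" "D2 \<subseteq> ?D"
    using D by (rule subset_set_mult)+
  have fin_S: "finite (?S ?D)" and fin_T: "finite (?T ?D)"
    using fin by (simp_all add: squares_def two_torsion_def)
  have \<delta>_ge: "\<delta>1 \<le> \<delta>" "\<delta>2 \<le> \<delta>"
    using card_mono[OF fin_S squares_mono[OF sub(1)]] card_mono[OF fin_S squares_mono[OF sub(2)]]
    by (simp_all add: card)
  have \<gamma>\<delta>_ge: "\<gamma>1 + \<delta>1 \<le> \<gamma> + \<delta>" "\<gamma>2 + \<delta>2 \<le> \<gamma> + \<delta>"
    using card_mono[OF fin_T two_torsion_mono[OF sub(1)]] card_mono[OF fin_T two_torsion_mono[OF sub(2)]]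
    by (simp_all add: card)

  have "\<beta> > 0" using assms(2) by simp
  let ?j = "all_ones \<beta>"
  have j: "?j \<in> D1" "?j \<in> D2" using assms(5,6) by (simp_all add: D1_def D2_def)
  \<comment> \<open>Every entry of the double is 2, and there is at least one coordinate.\<close>
  have jj: "?j \<otimes>\<^bsub>?G\<^esub> ?j \<noteq> \<one>\<^bsub>?G\<^esub>"
    using \<open>\<beta> > 0\<close> by (auto simp: all_ones_def mult_Zmod_power one_Zmod_power fun_eq_iff)
  let ?c = "card (D1 \<inter> D2)" and ?s = "card (?S D1 \<inter> ?S D2)"
  have prod: "card ?D * ?c = card D1 * card D2"
    using card_set_mult_Int[OF D fin(1,2)] .
  have prod_S: "card (?S ?D) * ?s = card (?S D1) * card (?S D2)"
    using card_set_mult_Int[OF S] fin squares_set_mult[of D1 D2] D[THEN subgroup.subset]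
    by (simp add: squares_def)

  have "{\<one>\<^bsub>?G\<^esub>, ?j \<otimes>\<^bsub>?G\<^esub> ?j} \<subseteq> ?S D1 \<inter> ?S D2"
    using j S[THEN subgroup.one_closed] by (auto simp: squares_def)
  then have "card {\<one>\<^bsub>?G\<^esub>, ?j \<otimes>\<^bsub>?G\<^esub> ?j} \<le> ?s"
    using fin by (intro card_mono) (auto simp: squares_def)
  then have "2 \<le> ?s" using jj by (simp split: if_splits)
  then have "2 ^ \<delta> * 2 \<le> card (?S ?D) * ?s" using card by simp
  also have "\<dots> = 2 ^ (\<delta>1 + \<delta>2)" unfolding prod_S using card by (simp add: power_add)
  \<comment> \<open>The form with \<open>\<delta> + 1\<close> on the left ensures that the natural
    subtraction in the goal does not truncate.\<close>
  finally have "(2::nat) ^ (\<delta> + 1) \<le> 2 ^ (\<delta>1 + \<delta>2)" by simp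
  then have \<delta>_le: "\<delta> + 1 \<le> \<delta>1 + \<delta>2" by (simp only: power_increasing_iff)

  have "?s < ?c"
  proof (rule psubset_card_mono)
    have "?S D1 \<subseteq> D1" "?S D2 \<subseteq> D2"
      using D by (auto simp: squares_def subgroup.m_closed)
    moreover have "?j \<notin> ?S D1"
      using square_two_torsion[OF D(1)] jj by (auto simp: two_torsion_def)
    ultimately show "?S D1 \<inter> ?S D2 \<subset> D1 \<inter> D2" using j by blast
  qed (use fin in simp)
  have \<gamma>\<delta>_less: "\<gamma> + \<delta> < (\<gamma>1 + \<delta>1) + (\<gamma>2 + \<delta>2)"
  proof -
    \<comment> \<open>A code of type (\<gamma>, \<delta>) has
      \<open>2 ^ (\<gamma> + \<delta>)\<close> times as many words as its double. Dividing
      \<open>prod\<close> by \<open>prod_S\<close> therefore relates the 2-torsion sizes;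
      \<open>?p\<close> is the common factor that cancels after cross-multiplication.\<close>
    let ?p = "(2::nat) ^ (\<delta> + \<delta>1 + \<delta>2)"
    have "2 ^ (\<gamma> + \<delta>) * ?c * ?p = (card ?D * ?c) * (card (?S D1) * card (?S D2))"
      by (simp add: card power_add power_mult power2_eq_square ac_simps)
    also have "\<dots> = (card D1 * card D2) * (card (?S ?D) * ?s)"
      unfolding prod prod_S ..
    also have "\<dots> = 2 ^ ((\<gamma>1 + \<delta>1) + (\<gamma>2 + \<delta>2)) * ?s * ?p"
      by (simp add: card power_add power_mult power2_eq_square ac_simps)
    finally have eq: "2 ^ (\<gamma> + \<delta>) * ?c = 2 ^ ((\<gamma>1 + \<delta>1) + (\<gamma>2 + \<delta>2)) * ?s"
      by simp
    have "2 ^ (\<gamma> + \<delta>) * ?c < 2 ^ ((\<gamma>1 + \<delta>1) + (\<gamma>2 + \<delta>2)) * ?c"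
      unfolding eq using \<open>?s < ?c\<close> by simp
    then show ?thesis by simp
  qed
  have "of_dual_type \<beta> \<gamma> \<delta> (C1 \<inter> C2)"
    using ty' C by (simp add: of_dual_type_def quaternary_linear_code_def D_dual subgroups_Inter_pair)
  with \<delta>_ge \<gamma>\<delta>_ge \<delta>_le \<gamma>\<delta>_less show ?thesis
    by (intro exI[of _ \<gamma>] exI[of _ \<delta>]) auto
qed

end
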